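(* Let $p>0$. The function $k_F(\mathbf{x}) := \log \operatorname{Tr}\left(\left(X_C(\mathbf{x})\right)^{-p}\right)$ is $L$-smooth on $\mathcal{P}$ with Lipschitz constant $$L_{k_F} = \frac{a_C^{p}}{n}\,p(p+1) \left(\max_i (AA^\intercal)_{ii} \right)\frac{\|A\|_2^2}{\lambda_{\min}(C)^{2+p}},$$ where $a_C$ is the upper bound on the maximum eigenvalue of $X_C(\mathbf{x})$, that is $$a_C = \lambda_{\max}(C) + \max_{i\in[m]} u_i \max_{j\in[m]} \|\mathbf{v}_j\|_2^2,$$ with $u_i$ denoting the upper bound of variable $x_i$.
   Context: $A\in\mathbb{R}^{m\times n}$ is a matrix with rows $\mathbf{v}_1,\dots,\mathbf{v}_m\in\mathbb{R}^n$ and full column rank; $[m]=\{1,\dots,m\}$. $\mathbf{l},\mathbf{u}\in\mathbb{N}_0^m$ are lower and upper bounds ($\mathbf{l}\le\mathbf{u}$ entrywise), $N$ is a positive integer, and $\mathcal{P} := [\mathbf{l},\mathbf{u}]\cap\{\mathbf{x}\in\mathbb{R}^m_{\ge 0} : \sum_{i=1}^m x_i = N\}$. It is assumed that $n$ linearly independent rows of $A$ have non-zero lower bounds, so that $C := A^\intercal \operatorname{diag}(\mathbf{l})A$ is positive definite. The Fusion information matrix is $X_C(\mathbf{x}) := C + A^\intercal\operatorname{diag}(\mathbf{x}-\mathbf{l})A$. $\lambda_{\min},\lambda_{\max}$ denote smallest and largest eigenvalue, and $\|A\|_2$ is the spectral norm. Real powers of positive definite matrices are defined through the eigendecomposition.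 A differentiable function $h$ is $L$-smooth on a set $S$ (with Lipschitz constant $L$) if $\|\nabla h(\mathbf{x})-\nabla h(\mathbf{y})\|_2\le L\|\mathbf{x}-\mathbf{y}\|_2$ for all $\mathbf{x},\mathbf{y}\in S$.
   Formalization: The formula for a_C need not bound the maximum eigenvalue of X_C(x), and the smoothness claim can then fail; the formal theorem additionally assumes that a_C, given by this formula, is an upper bound on the maximum eigenvalue of X_C(x) for all x in P. *)

theory Defs
  imports "HOL-Analysis.Analysis"
begin

definition diag :: "real^'k \<Rightarrow> real^'k^'k" where
  "diag d = (\<chi> i j. if i = j then d $ i else 0)"

definition eigenvalues :: "real^'k^'k \<Rightarrow> real set" where
  "eigenvalues X = {\<mu>. \<exists>w. w \<noteq> 0 \<and> X *v w = \<mu> *\<^sub>R w}"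

text \<open>
  These two are meaningful for symmetric \<open>X\<close>, where the set of (real) eigenvalues is
  finite and nonempty.
\<close>

definition lambda_min :: "real^'k^'k \<Rightarrow> real" where
  "lambda_min X = Min (eigenvalues X)"

definition lambda_max :: "real^'k^'k \<Rightarrow> real" where
  "lambda_max X = Max (eigenvalues X)"

definition spectral_norm :: "real^'n^'m \<Rightarrow> real" where
  "spectral_norm A = onorm (\<lambda>w. A *v w)"

text \<open>
  Real power of a symmetric positive definite matrix.  The result does not depend on the
  chosen eigendecomposition, so the definite description denotes; for other matrices the
  value is unspecified.
\<close>

definition mat_powr :: "real^'k^'k \<Rightarrow> real \<Rightarrow> real^'k^'k" where
  "mat_powr X p = (THE Y. \<exists>Q d. orthogonal_matrix Q \<and> (\<forall>i. 0 < d $ i) \<and>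
     X = Q ** diag d ** transpose Q \<and>
     Y = Q ** diag (\<chi> i. d $ i powr p) ** transpose Q)"

definition real_vec :: "nat^'m \<Rightarrow> real^'m" where
  "real_vec b = (\<chi> i. real (b $ i))"

definition feasible :: "nat^'m \<Rightarrow> nat^'m \<Rightarrow> nat \<Rightarrow> (real^'m) set" where
  "feasible l u N = cbox (real_vec l) (real_vec u) \<inter>
     {x. (\<forall>i. 0 \<le> x $ i) \<and> (\<Sum>i\<in>UNIV. x $ i) = real N}"

definition C_mat :: "real^'n^'m \<Rightarrow> nat^'m \<Rightarrow> real^'n^'n" where
  "C_mat A l = transpose A ** diag (real_vec l) ** A"

definition X_mat :: "real^'n^'m \<Rightarrow> nat^'m \<Rightarrow> real^'m \<Rightarrow> real^'n^'n" where
  "X_mat A l x = C_mat A l + transpose A ** diag (x - real_vec l) ** A"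

definition k_F :: "real^'n^'m \<Rightarrow> nat^'m \<Rightarrow> real \<Rightarrow> real^'m \<Rightarrow> real" where
  "k_F A l p x = ln (trace (mat_powr (X_mat A l x) (- p)))"

text \<open>
  Differentiability is required in the ambient space at every point of \<open>S\<close>, so the
  gradient \<open>g\<close> is uniquely determined on \<open>S\<close> even if \<open>S\<close> has empty interior.
\<close>

definition smooth_on_with :: "real \<Rightarrow> ('a::real_inner) set \<Rightarrow> ('a \<Rightarrow> real) \<Rightarrow> bool" where
  "smooth_on_with L S h \<longleftrightarrow>
     (\<exists>g. (\<forall>x\<in>S. GDERIV h x :> g x) \<and>
          (\<forall>x\<in>S. \<forall>y\<in>S. norm (g x - g y) \<le> L * norm (x - y)))"

end

theory Submission
  imports Defs
begin

text \<open>
  Write \<open>\<phi> X = Tr X\<^bsup>-p\<^esup>\<close> and let \<open>X = Q diag d Q\<^sup>T\<close>, \<open>Y = R diag e R\<^sup>T\<close>.  With the doubly stochastic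
  matrix \<open>W\<^sub>k\<^sub>l = ((Q\<^sup>T R)\<^sub>k\<^sub>l)\<^sup>2\<close>, all of \<open>\<phi> X\<close>, \<open>\<phi> Y\<close>, \<open>X\<^bsup>-p-1\<^esup> \<bullet> (Y - X)\<close> and the squared Frobenius norm of
  \<open>Y - X\<close> are sums \<open>\<Sum>\<^sub>k\<^sub>l W\<^sub>k\<^sub>l f (d\<^sub>k, e\<^sub>l)\<close>, so matrix inequalities reduce to scalar ones.  In this way the error of the
  first-order expansion of \<open>ln \<circ> \<phi>\<close> at \<open>X\<close> is nonnegative by Jensen's inequality, and it is bounded above by
  \<open>K / (2 \<phi> X)\<close> times the squared Frobenius norm of \<open>Y - X\<close> by Taylor's theorem for \<open>t \<mapsto> t\<^bsup>-p\<^esup>\<close>,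
  where \<open>K\<close> is the value of its second derivative at a common lower bound of the eigenvalues.  The squared
  Frobenius norm of \<open>A\<^sup>T diag h A\<close> is at most the largest squared row norm of \<open>A\<close>, times the squared
  spectral norm of \<open>A\<close>, times the squared norm of \<open>h\<close>.

  A quadratic bound on the first-order error on a ball makes the gradient Lipschitz for the
  endpoints of a diameter.  Such balls leave the feasible set, where the eigenvalue bounds get slightly worse;
  subdividing a feasible segment into shorter and shorter pieces removes this loss.
\<close>

subsection \<open>Diagonalization of symmetric matrices\<close>

text \<open>A maximizer of the quadratic form \<open>w \<bullet> f w\<close> on the compact unit
  sphere of \<open>S\<close> is an eigenvector, because the form cannot grow to first order in any
  direction of \<open>S\<close> orthogonal to it.\<close>

lemma self_adjoint_eigenvector_exists:
  fixes f :: "'a::euclidean_space \<Rightarrow> 'a"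
  assumes f: "linear f" and sym: "\<And>x y. f x \<bullet> y = x \<bullet> f y"
    and S: "subspace S" "S \<noteq> {0}" and inv: "f ` S \<subseteq> S"
  obtains v \<mu> where "v \<in> S" "norm v = 1" "f v = \<mu> *\<^sub>R v"
proof -
  let ?K = "S \<inter> sphere 0 1"
  have "compact ?K"
    using S by (simp add: closed_subspace closed_Int_compact)
  moreover have "?K \<noteq> {}"
  proof -
    obtain w where w: "w \<in> S" "w \<noteq> 0"
      using S subspace_0 by blast
    then have "w /\<^sub>R norm w \<in> ?K"
      using S by (simp add: subspace_scale)
    then show ?thesis by blast
  qed
  moreover have "continuous_on ?K (\<lambda>w. w \<bullet> f w)"
    by (intro continuous_intros linear_continuous_on) (use f in \<open>simp add: linear_conv_bounded_linear\<close>)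
  ultimately obtain v where v: "v \<in> ?K" and max: "\<And>w. w \<in> ?K \<Longrightarrow> w \<bullet> f w \<le> v \<bullet> f v"
    using continuous_attains_sup[of ?K "\<lambda>w. w \<bullet> f w"] by blast
  define \<mu> where "\<mu> = v \<bullet> f v"
  have vv: "v \<bullet> v = 1" and vS: "v \<in> S" and nv: "norm v = 1"
    using v by (auto simp: norm_eq_1)
  have quad: "w \<bullet> f w \<le> \<mu> * (w \<bullet> w)" if "w \<in> S" for w
  proof (cases "w = 0")
    case True
    then show ?thesis by simp
  next
    case False
    then have "w /\<^sub>R norm w \<in> ?K"
      using S that by (simp add: subspace_scale)
    from max[OF this] have "(w \<bullet> f w) / (norm w)\<^sup>2 \<le> \<mu>"
      using f by (simp add: linear_cmul \<mu>_def power2_eq_square divide_inverse mult_ac)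
    then show ?thesis
      using False by (simp add: pos_divide_le_eq dot_square_norm)
  qed
  \<comment> \<open>Comparing \<open>v + t *\<^sub>R w\<close> with the maximum leaves a term linear
    in \<open>t\<close> bounded by a quadratic one. At \<open>t = b / (e + 1)\<close> this reads
    \<open>t\<^sup>2 * (e + 2) \<le> 0\<close>; the 1 guards against \<open>e = 0\<close>.\<close>
  have ortho: "v \<bullet> f w = 0" if w: "w \<in> S" "v \<bullet> w = 0" for w
  proof (rule ccontr)
    assume ne: "v \<bullet> f w \<noteq> 0"
    define b where "b = v \<bullet> f w"
    define e where "e = \<mu> * (w \<bullet> w) - w \<bullet> f w"
    have main: "2 * t * b \<le> t\<^sup>2 * e" for t
    proof -
      have "v + t *\<^sub>R w \<in> S"
        using vS w S by (simp add: subspace_add subspace_scale)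
      from quad[OF this] show ?thesis
        using f w vv sym[of w v]
        by (simp add: linear_add linear_cmul inner_add inner_commute b_def e_def \<mu>_def
            power2_eq_square algebra_simps)
    qed
    have "e \<ge> 0" using quad[OF w(1)] by (simp add: e_def)
    define t where "t = b / (e + 1)"
    have b: "b = t * (e + 1)" using \<open>e \<ge> 0\<close> by (simp add: t_def)
    have "t \<noteq> 0" using ne \<open>e \<ge> 0\<close> by (simp add: b_def t_def)
    then have "t\<^sup>2 > 0" by simp
    moreover have "t\<^sup>2 * (e + 2) \<le> 0"
      using main[of t] by (simp add: b power2_eq_square algebra_simps)
    ultimately show False
      using \<open>e \<ge> 0\<close> by (simp add: mult_le_0_iff)
  qed
  \<comment> \<open>The part of \<open>f v\<close> orthogonal to \<open>v\<close>. By
    self-adjointness its squared norm equals \<open>v \<bullet> f w\<close>, which was just shown to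
    vanish.\<close>
  define w where "w = f v - \<mu> *\<^sub>R v"
  have wS: "w \<in> S"
    unfolding w_def using S inv vS by (intro subspace_diff subspace_scale) auto
  have vw: "v \<bullet> w = 0"
    using vv by (simp add: w_def inner_diff \<mu>_def)
  have "w \<bullet> w = f v \<bullet> w - \<mu> * (v \<bullet> w)"
    by (simp add: w_def inner_diff_left)
  also have "\<dots> = 0"
    using ortho[OF wS vw] vw by (simp add: sym)
  finally have "f v = \<mu> *\<^sub>R v"
    by (simp add: w_def)
  then show ?thesis
    using that vS nv by blast
qed

text \<open>Induction on the dimension: split off one unit eigenvector; its orthogonal complement
  inside \<open>S\<close> is again invariant because \<open>f\<close> is self-adjoint.\<close>

lemma self_adjoint_orthonormal_eigenbasis:
  fixes f :: "'a::euclidean_space \<Rightarrow> 'a"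
  assumes f: "linear f" and sym: "\<And>x y. f x \<bullet> y = x \<bullet> f y"
    and "subspace S" and "f ` S \<subseteq> S"
  shows "\<exists>B \<subseteq> S. pairwise orthogonal B \<and> (\<forall>v\<in>B. norm v = 1 \<and> (\<exists>\<mu>. f v = \<mu> *\<^sub>R v)) \<and> S \<subseteq> span B"
  using assms(3,4)
proof (induction "dim S" arbitrary: S rule: less_induct)
  case less
  show ?case
  proof (cases "S = {0}")
    case True
    then show ?thesis
      by (intro exI[of _ "{}"]) auto
  next
    case False
    obtain v \<mu> where v: "v \<in> S" "norm v = 1" "f v = \<mu> *\<^sub>R v"
      using self_adjoint_eigenvector_exists[OF f sym less.prems(1) False less.prems(2)] .
    let ?T = "S \<inter> {w. v \<bullet> w = 0}"
    have T: "subspace ?T"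
      using less.prems(1) by (simp add: subspace_Int subspace_hyperplane subspace_inter)
    have "v \<notin> ?T" using v by (auto simp: norm_eq_1)
    then have "?T \<subset> S" using v by blast
    then have "span ?T \<subset> span S"
      using T less.prems(1) by (metis span_eq_iff)
    then have "dim ?T < dim S"
      by (rule dim_psubset)
    moreover have "f ` ?T \<subseteq> ?T"
    proof safe
      fix w assume "w \<in> S" "v \<bullet> w = 0"
      then show "f w \<in> S" "v \<bullet> f w = 0"
        using less.prems(2) sym[of v w] v by auto
    qed
    ultimately obtain B where B: "B \<subseteq> ?T" "pairwise orthogonal B"
      "\<forall>v\<in>B. norm v = 1 \<and> (\<exists>\<mu>. f v = \<mu> *\<^sub>R v)" "?T \<subseteq> span B"
      using less.hyps[OF _ T] by blast
    have "S \<subseteq> span (insert v B)"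
    proof
      fix w assume w: "w \<in> S"
      have "w - (v \<bullet> w) *\<^sub>R v \<in> ?T"
        using w v less.prems(1)
        by (auto simp: subspace_diff subspace_scale inner_diff norm_eq_1)
      then have "w - (v \<bullet> w) *\<^sub>R v \<in> span B" using B by blast
      then show "w \<in> span (insert v B)"
        by (auto simp: span_breakdown_eq)
    qed
    moreover have "pairwise orthogonal (insert v B)"
      using B by (auto simp: pairwise_insert orthogonal_def inner_commute)
    ultimately show ?thesis
      using B v by (intro exI[of _ "insert v B"]) auto
  qed
qed

lemma conjugated_diag_component:
  fixes Q :: "real^'k^'k"
  shows "(Q ** diag a ** transpose Q) $ i $ j = (\<Sum>k\<in>UNIV. a $ k * Q $ i $ k * Q $ j $ k)"
  by (simp add: matrix_matrix_mult_def diag_def transpose_def if_distrib cong: if_cong)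
    (simp add: mult_ac)

text \<open>The orthonormal eigenbasis has \<open>CARD('k)\<close> elements, so it can be indexed by
  \<open>'k\<close> and used as the columns of \<open>Q\<close>; the eigenvector equations then say
  \<open>X ** Q = Q ** diag d\<close>.\<close>

lemma symmetric_matrix_diagonalization:
  fixes X :: "real^'k^'k"
  assumes sym: "transpose X = X"
  obtains Q d where "orthogonal_matrix Q" "X = Q ** diag d ** transpose Q"
proof -
  have "(X *v x) \<bullet> y = x \<bullet> (X *v y)" for x y
    by (metis dot_lmul_matrix sym transpose_matrix_vector)
  then obtain B where B: "pairwise orthogonal B" "UNIV \<subseteq> span B"
    "\<forall>v\<in>B. norm v = 1 \<and> (\<exists>\<mu>. X *v v = \<mu> *\<^sub>R v)"
    using self_adjoint_orthonormal_eigenbasis[of "(*v) X" UNIV] by auto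
  have "0 \<notin> B" using B by force
  then have ind: "independent B"
    using B(1) by (simp add: pairwise_orthogonal_independent)
  have "span B = UNIV" using B(2) by auto
  then have "dim B = dim (UNIV :: (real^'k) set)"
    by (metis dim_span)
  then have "card B = CARD('k)"
    using ind by (simp add: dim_eq_card_independent)
  then obtain b :: "'k \<Rightarrow> real^'k" where b: "bij_betw b UNIV B"
    using finite_same_card_bij[OF finite_class.finite_UNIV independent_imp_finite[OF ind]] by auto
  have bB: "b i \<in> B" for i using b by (auto simp: bij_betw_def)
  have "\<forall>i. \<exists>\<mu>. X *v b i = \<mu> *\<^sub>R b i"
    using B(3) bB by blast
  then obtain d0 where d0: "\<And>i. X *v b i = d0 i *\<^sub>R b i"
    unfolding choice_iff by blast
  define Q :: "real^'k^'k" where "Q = (\<chi> i j. b j $ i)"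
  define d where "d = (\<chi> i. d0 i)"
  have col: "column i Q = b i" for i by (simp add: column_def Q_def vec_eq_iff)
  have "orthogonal (b i) (b j)" if "i \<noteq> j" for i j
    using B(1) bB that bij_betw_imp_inj_on[OF b] by (simp add: pairwise_def inj_eq)
  then have Q: "orthogonal_matrix Q"
    unfolding orthogonal_matrix_orthonormal_columns col using B(3) bB by (intro conjI allI impI) auto
  have "X ** Q = Q ** diag d"
  proof -
    have "(X ** Q) $ i $ j = (Q ** diag d) $ i $ j" for i j
    proof -
      have "(X ** Q) $ i $ j = (X *v b j) $ i"
        by (simp add: matrix_matrix_mult_def matrix_vector_mult_def Q_def)
      also have "\<dots> = (Q ** diag d) $ i $ j"
        by (simp add: d0 matrix_matrix_mult_def Q_def diag_def d_def if_distrib cong: if_cong)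
      finally show ?thesis .
    qed
    then show ?thesis by (simp add: vec_eq_iff)
  qed
  then have XQ: "X ** Q ** transpose Q = Q ** diag d ** transpose Q"
    by simp
  have "X = Q ** diag d ** transpose Q"
    using Q unfolding XQ[symmetric] by (simp add: orthogonal_matrix_def matrix_mul_assoc[symmetric])
  then show ?thesis using that Q by blast
qed

text \<open>The inner product on nested vectors is the Frobenius one. Both matrices are sums of
  rank-one projections onto columns, and two such projections have as inner product the squared
  inner product of the columns.\<close>

lemma inner_conjugated_diag:
  fixes Q R :: "real^'k^'k"
  shows "(Q ** diag a ** transpose Q) \<bullet> (R ** diag b ** transpose R)
    = (\<Sum>k\<in>UNIV. \<Sum>l\<in>UNIV. a $ k * b $ l * ((transpose Q ** R) $ k $ l)\<^sup>2)" (is "?L = ?R")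
proof -
  let ?t = "\<lambda>i j k l. a $ k * b $ l * (Q $ i $ k * R $ i $ l) * (Q $ j $ k * R $ j $ l)"
  have "?L = (\<Sum>i\<in>UNIV. \<Sum>j\<in>UNIV. \<Sum>k\<in>UNIV. \<Sum>l\<in>UNIV. ?t i j k l)"
    by (simp add: inner_vec_def conjugated_diag_component sum_product mult_ac)
  also have "\<dots> = (\<Sum>i\<in>UNIV. \<Sum>k\<in>UNIV. \<Sum>j\<in>UNIV. \<Sum>l\<in>UNIV. ?t i j k l)"
    by (intro sum.cong refl sum.swap)
  also have "\<dots> = (\<Sum>k\<in>UNIV. \<Sum>i\<in>UNIV. \<Sum>l\<in>UNIV. \<Sum>j\<in>UNIV. ?t i j k l)"
    by (subst sum.swap) (intro sum.cong refl sum.swap)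
  also have "\<dots> = (\<Sum>k\<in>UNIV. \<Sum>l\<in>UNIV. \<Sum>i\<in>UNIV. \<Sum>j\<in>UNIV. ?t i j k l)"
    by (intro sum.cong refl sum.swap)
  also have "\<dots> = ?R"
    by (simp add: matrix_matrix_mult_def transpose_def power2_eq_square sum_product sum_distrib_left mult_ac)
  finally show ?thesis .
qed

lemma orthogonal_matrix_row_sum_squares:
  fixes S :: "real^'k^'k"
  assumes "orthogonal_matrix S"
  shows "(\<Sum>l\<in>UNIV. (S $ k $ l)\<^sup>2) = 1"
proof -
  have "(S ** transpose S) $ k $ k = 1"
    using assms by (simp add: orthogonal_matrix_def mat_def)
  then show ?thesis
    by (simp add: matrix_matrix_mult_def transpose_def power2_eq_square)
qed

lemma orthogonal_matrix_column_sum_squares: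
  fixes S :: "real^'k^'k"
  assumes "orthogonal_matrix S"
  shows "(\<Sum>k\<in>UNIV. (S $ k $ l)\<^sup>2) = 1"
  using orthogonal_matrix_row_sum_squares[of "transpose S" l] assms
  by (simp only: orthogonal_matrix_transpose) (simp add: transpose_def)

lemma trace_conjugated_diag:
  fixes Q :: "real^'k^'k"
  assumes "orthogonal_matrix Q"
  shows "trace (Q ** diag a ** transpose Q) = (\<Sum>k\<in>UNIV. a $ k)"
proof -
  have "trace (Q ** diag a ** transpose Q) = (\<Sum>i\<in>UNIV. \<Sum>k\<in>UNIV. a $ k * (Q $ i $ k)\<^sup>2)"
    by (simp add: trace_def conjugated_diag_component power2_eq_square mult_ac)
  also have "\<dots> = (\<Sum>k\<in>UNIV. a $ k * (\<Sum>i\<in>UNIV. (Q $ i $ k)\<^sup>2))"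
    by (subst sum.swap) (simp add: sum_distrib_left)
  finally show ?thesis
    using assms by (simp add: orthogonal_matrix_column_sum_squares)
qed

section \<open>Functions of symmetric matrices and their eigenvalues\<close>

lemma diag_mult_vec: "diag a *v v = (\<chi> k. a $ k * v $ k)"
  by (simp add: matrix_vector_mult_def diag_def vec_eq_iff if_distrib[of "\<lambda>x. x * _"] cong: if_cong)

lemma conjugated_diag_mult_vec:
  fixes Q :: "real^'k^'k"
  assumes "orthogonal_matrix Q"
  shows "transpose Q *v ((Q ** diag a ** transpose Q) *v w) = (\<chi> k. a $ k * (transpose Q *v w) $ k)"
proof -
  have "transpose Q *v ((Q ** diag a ** transpose Q) *v w)
      = ((transpose Q ** Q) ** diag a ** transpose Q) *v w"
    by (simp only: matrix_vector_mul_assoc matrix_mul_assoc)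
  also have "\<dots> = diag a *v (transpose Q *v w)"
    using assms by (simp add: orthogonal_matrix_def matrix_vector_mul_assoc del: transpose_matrix_vector)
  also have "\<dots> = (\<chi> k. a $ k * (transpose Q *v w) $ k)"
    by (rule diag_mult_vec)
  finally show ?thesis .
qed

lemma orthogonal_matrix_mult_eq_iff:
  fixes Q :: "real^'k^'k"
  assumes "orthogonal_matrix Q"
  shows "transpose Q *v v = transpose Q *v w \<longleftrightarrow> v = w"
proof
  assume "transpose Q *v v = transpose Q *v w"
  then have "(Q ** transpose Q) *v v = (Q ** transpose Q) *v w"
    by (simp only: matrix_vector_mul_assoc[symmetric])
  then show "v = w" using assms by (simp add: orthogonal_matrix_def)
qed simp

text \<open>
  A function of a diagonalizable matrix is determined by its action on eigenvectors,
  so it does not depend on the chosen eigendecomposition.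
\<close>

lemma conjugated_diag_fun_eigenvector:
  fixes Q :: "real^'k^'k"
  assumes Q: "orthogonal_matrix Q" and w: "(Q ** diag d ** transpose Q) *v w = \<mu> *\<^sub>R w"
  shows "(Q ** diag (\<chi> i. f (d $ i)) ** transpose Q) *v w = f \<mu> *\<^sub>R w"
proof -
  have "d $ k * (transpose Q *v w) $ k = \<mu> * (transpose Q *v w) $ k" for k
    using conjugated_diag_mult_vec[OF Q, of d w] unfolding w
    by (auto simp: vec_eq_iff matrix_vector_mult_scaleR simp del: transpose_matrix_vector)
  \<comment> \<open>In each eigencoordinate either \<open>w\<close> vanishes or
    \<open>d $ k = \<mu>\<close>.\<close>
  then have "f (d $ k) * (transpose Q *v w) $ k = f \<mu> * (transpose Q *v w) $ k" for k
    by (metis mult_cancel_right)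
  then have "transpose Q *v ((Q ** diag (\<chi> i. f (d $ i)) ** transpose Q) *v w) = transpose Q *v (f \<mu> *\<^sub>R w)"
    using Q by (simp add: conjugated_diag_mult_vec vec_eq_iff matrix_vector_mult_scaleR
        del: transpose_matrix_vector)
  then show ?thesis
    using Q orthogonal_matrix_mult_eq_iff by blast
qed

lemma conjugated_diag_mult_column:
  fixes Q :: "real^'k^'k"
  assumes Q: "orthogonal_matrix Q"
  shows "(Q ** diag d ** transpose Q) *v column k Q = d $ k *\<^sub>R column k Q"
proof -
  have "transpose Q *v column k Q = axis k 1"
    using Q by (simp add: orthogonal_matrix_def vec_eq_iff axis_def mat_def
        matrix_matrix_mult_def transpose_def column_def matrix_vector_mult_def del: transpose_matrix_vector)
  then have "transpose Q *v ((Q ** diag d ** transpose Q) *v column k Q)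
      = transpose Q *v (d $ k *\<^sub>R column k Q)"
    using Q by (simp add: conjugated_diag_mult_vec vec_eq_iff matrix_vector_mult_scaleR axis_def
        del: transpose_matrix_vector)
  then show ?thesis
    using Q orthogonal_matrix_mult_eq_iff by blast
qed

lemma matrix_eq_if_columns:
  fixes Q :: "real^'k^'k" and Y Z :: "real^'k^'m"
  assumes Q: "orthogonal_matrix Q" and "\<And>k. Y *v column k Q = Z *v column k Q"
  shows "Y = Z"
proof -
  have "Y ** Q = Z ** Q"
    using assms(2)
    by (simp add: vec_eq_iff matrix_matrix_mult_def matrix_vector_mult_def column_def)
  then have "Y ** (Q ** transpose Q) = Z ** (Q ** transpose Q)"
    by (simp add: matrix_mul_assoc)
  then show ?thesis
    using Q by (simp add: orthogonal_matrix_def)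
qed

text \<open>This resolves the definite description. A competing decomposition of the same matrix
  sees the columns of \<open>Q\<close> as eigenvectors, so its power acts on them by
  \<open>d $ k powr p\<close> as well.\<close>

lemma mat_powr_conjugated_diag:
  fixes Q :: "real^'k^'k"
  assumes Q: "orthogonal_matrix Q" and d: "\<And>i. 0 < d $ i"
  shows "mat_powr (Q ** diag d ** transpose Q) p = Q ** diag (\<chi> i. d $ i powr p) ** transpose Q"
  unfolding mat_powr_def
proof (rule the_equality)
  fix Y
  assume "\<exists>R e. orthogonal_matrix R \<and> (\<forall>i. 0 < e $ i) \<and>
     Q ** diag d ** transpose Q = R ** diag e ** transpose R \<and>
     Y = R ** diag (\<chi> i. e $ i powr p) ** transpose R"
  then obtain R e where R: "orthogonal_matrix R"
    and X: "Q ** diag d ** transpose Q = R ** diag e ** transpose R"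
    and Y: "Y = R ** diag (\<chi> i. e $ i powr p) ** transpose R" by blast
  show "Y = Q ** diag (\<chi> i. d $ i powr p) ** transpose Q"
  proof (rule matrix_eq_if_columns[OF Q])
    fix k
    have "(R ** diag e ** transpose R) *v column k Q = d $ k *\<^sub>R column k Q"
      using conjugated_diag_mult_column[OF Q, of d] X by simp
    then show "Y *v column k Q = Q ** diag (\<chi> i. d $ i powr p) ** transpose Q *v column k Q"
      using conjugated_diag_fun_eigenvector[OF R, of e _ _ "\<lambda>x. x powr p"]
        conjugated_diag_mult_column[OF Q] by (simp add: Y)
  qed
qed (use assms in blast)

text \<open>The spectrum is thereby finite and nonempty, so \<open>Min\<close> and
  \<open>Max\<close> in \<open>lambda_min\<close> and \<open>lambda_max\<close> behave as
  intended.\<close>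

lemma eigenvalues_conjugated_diag:
  fixes Q :: "real^'k^'k"
  assumes Q: "orthogonal_matrix Q"
  shows "eigenvalues (Q ** diag d ** transpose Q) = range (($) d)"
proof safe
  fix \<mu> assume "\<mu> \<in> eigenvalues (Q ** diag d ** transpose Q)"
  then obtain w where w: "w \<noteq> 0" "(Q ** diag d ** transpose Q) *v w = \<mu> *\<^sub>R w"
    by (auto simp: eigenvalues_def)
  have "d $ k * (transpose Q *v w) $ k = \<mu> * (transpose Q *v w) $ k" for k
    using conjugated_diag_mult_vec[OF Q, of d w] unfolding w
    by (auto simp: vec_eq_iff matrix_vector_mult_scaleR simp del: transpose_matrix_vector)
  moreover have "transpose Q *v w \<noteq> 0"
    using orthogonal_matrix_mult_eq_iff[OF Q, of w 0] w by simp
  then obtain k where "(transpose Q *v w) $ k \<noteq> 0"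
    by (auto simp: vec_eq_iff simp del: transpose_matrix_vector)
  ultimately have "d $ k = \<mu>" by (metis mult_cancel_right)
  then show "\<mu> \<in> range (($) d)" by auto
next
  fix k
  have "column k Q \<noteq> 0"
    using Q by (metis orthogonal_matrix_orthonormal_columns norm_zero zero_neq_one)
  then show "d $ k \<in> eigenvalues (Q ** diag d ** transpose Q)"
    using conjugated_diag_mult_column[OF Q] by (auto simp: eigenvalues_def)
qed

section \<open>Quadratic forms and eigenvalue bounds\<close>

lemma inner_conjugated_diag_mult_vec:
  fixes Q :: "real^'k^'k"
  assumes Q: "orthogonal_matrix Q"
  shows "w \<bullet> ((Q ** diag d ** transpose Q) *v w) = (\<Sum>k\<in>UNIV. d $ k * ((transpose Q *v w) $ k)\<^sup>2)"
proof -
  have "w \<bullet> ((Q ** diag d ** transpose Q) *v w)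
      = (transpose Q *v w) \<bullet> (transpose Q *v ((Q ** diag d ** transpose Q) *v w))"
    using Q by (metis dot_lmul_matrix matrix_mul_lid matrix_vector_mul_assoc matrix_vector_mul_lid
        orthogonal_matrix_def transpose_matrix_vector)
  then show ?thesis
    unfolding conjugated_diag_mult_vec[OF Q]
    by (simp add: inner_vec_def power2_eq_square mult_ac del: transpose_matrix_vector)
qed

lemma norm_orthogonal_matrix_mult:
  fixes Q :: "real^'k^'k"
  assumes Q: "orthogonal_matrix Q"
  shows "(\<Sum>k\<in>UNIV. ((transpose Q *v w) $ k)\<^sup>2) = (norm w)\<^sup>2"
proof -
  have "(transpose Q *v w) \<bullet> (transpose Q *v w) = w \<bullet> w"
    using Q by (metis dot_lmul_matrix matrix_vector_mul_assoc matrix_vector_mul_lid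
        orthogonal_matrix_def transpose_matrix_vector)
  then show ?thesis
    by (simp add: power2_norm_eq_inner) (simp add: inner_vec_def power2_eq_square)
qed

lemma symmetric_matrix_quadratic_form_bounds:
  fixes X :: "real^'k^'k"
  assumes "transpose X = X"
  shows "lambda_min X * (norm w)\<^sup>2 \<le> w \<bullet> (X *v w)"
    and "w \<bullet> (X *v w) \<le> lambda_max X * (norm w)\<^sup>2"
proof -
  obtain Q d where Q: "orthogonal_matrix Q" and X: "X = Q ** diag d ** transpose Q"
    using symmetric_matrix_diagonalization[OF assms] .
  have d: "lambda_min X \<le> d $ k" "d $ k \<le> lambda_max X" for k
    by (auto simp: lambda_min_def lambda_max_def X eigenvalues_conjugated_diag[OF Q])
  have X_form: "w \<bullet> (X *v w) = (\<Sum>k\<in>UNIV. d $ k * ((transpose Q *v w) $ k)\<^sup>2)"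
    unfolding X by (rule inner_conjugated_diag_mult_vec[OF Q])
  show "lambda_min X * (norm w)\<^sup>2 \<le> w \<bullet> (X *v w)" "w \<bullet> (X *v w) \<le> lambda_max X * (norm w)\<^sup>2"
    unfolding X_form norm_orthogonal_matrix_mult[OF Q, of w, symmetric] sum_distrib_left
    using d by (auto intro!: sum_mono mult_right_mono)
qed

lemma lambda_min_eigenvalue:
  fixes X :: "real^'k^'k"
  assumes "transpose X = X"
  shows "lambda_min X \<in> eigenvalues X"
proof -
  obtain Q d where Q: "orthogonal_matrix Q" and X: "X = Q ** diag d ** transpose Q"
    using symmetric_matrix_diagonalization[OF assms] .
  show ?thesis
    unfolding lambda_min_def X eigenvalues_conjugated_diag[OF Q] by (rule Min_in) auto
qed

text \<open>Bounds on the quadratic form pass to the eigenvalues by testing on the columns of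
  \<open>Q\<close>, which are unit eigenvectors.\<close>

lemma bounded_symmetric_matrix_diagonalization:
  fixes X :: "real^'k^'k"
  assumes "transpose X = X"
    and lower: "\<And>w. b * (norm w)\<^sup>2 \<le> w \<bullet> (X *v w)" and upper: "\<And>w. w \<bullet> (X *v w) \<le> c * (norm w)\<^sup>2"
  obtains Q d where "orthogonal_matrix Q" "X = Q ** diag d ** transpose Q" "\<And>k. b \<le> d $ k" "\<And>k. d $ k \<le> c"
proof -
  obtain Q d where Q: "orthogonal_matrix Q" and X: "X = Q ** diag d ** transpose Q"
    using symmetric_matrix_diagonalization[OF assms(1)] .
  have n: "norm (column k Q) = 1" for k
    using Q by (simp add: orthogonal_matrix_orthonormal_columns)
  have "column k Q \<bullet> (X *v column k Q) = d $ k" for k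
    using n[of k] by (simp add: X conjugated_diag_mult_column[OF Q] norm_eq_1)
  then have "b \<le> d $ k" "d $ k \<le> c" for k
    using lower[of "column k Q"] upper[of "column k Q"] n[of k] by auto
  then show ?thesis using that Q X by blast
qed

subsection \<open>The logarithm of the trace of a negative power\<close>

text \<open>The second derivative \<open>p * (p + 1) * t powr (- p - 2)\<close> is decreasing, so on
  arguments above \<open>b\<close> it is at most its value at \<open>b\<close>.\<close>

lemma powr_minus_Taylor_upper:
  fixes p b s t :: real
  assumes p: "p > 0" and b: "b > 0" and st: "b \<le> s" "b \<le> t"
  shows "t powr (- p) - s powr (- p) + p * s powr (- p - 1) * (t - s)
    \<le> p * (p + 1) / b powr (p + 2) / 2 * (t - s)\<^sup>2"
proof (cases "t = s")
  case True
  then show ?thesis by simp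
next
  case False
  \<comment> \<open>The function and its first two derivatives, indexed by order as
    \<open>Taylor\<close> expects.\<close>
  define diff :: "nat \<Rightarrow> real \<Rightarrow> real" where
    "diff = (\<lambda>m x. if m = 0 then x powr (- p) else if m = 1 then - p * x powr (- p - 1)
       else p * (p + 1) * x powr (- p - 2))"
  have "\<forall>m x. m < (2::nat) \<and> b \<le> x \<and> x \<le> max s t \<longrightarrow> DERIV (diff m) x :> diff (Suc m) x"
  proof (intro allI impI)
    fix m :: nat and x assume "m < 2 \<and> b \<le> x \<and> x \<le> max s t"
    then have x: "x > 0" "m = 0 \<or> m = 1" using b by auto
    have "((\<lambda>x. x powr (- p)) has_real_derivative - p * x powr (- p - 1)) (at x)"
      using x by (auto intro!: derivative_eq_intros)
    moreover have "((\<lambda>x. - p * x powr (- p - 1)) has_real_derivative p * (p + 1) * x powr (- p - 2)) (at x)"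
      using x by (auto intro!: derivative_eq_intros simp: algebra_simps)
    ultimately show "DERIV (diff m) x :> diff (Suc m) x"
      using x by (auto simp: diff_def)
  qed
  from Taylor[where n = 2 and f = "diff 0" and c = s and x = t, OF _ refl this]
  obtain \<xi> where \<xi>: "if t < s then t < \<xi> \<and> \<xi> < s else s < \<xi> \<and> \<xi> < t"
    "diff 0 t = (\<Sum>m<2. diff m s / fact m * (t - s) ^ m) + diff 2 \<xi> / fact 2 * (t - s)\<^sup>2"
    using st False by auto
  have "b \<le> \<xi>" using \<xi>(1) st by (auto split: if_splits)
  have "\<xi> powr (- p - 2) \<le> b powr (- p - 2)"
    using \<open>b \<le> \<xi>\<close> b p by (intro powr_mono2') auto
  also have "\<dots> = 1 / b powr (p + 2)"
    using powr_minus[of b "p + 2"] by (simp add: divide_inverse)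
  finally have "p * (p + 1) * \<xi> powr (- p - 2) / 2 * (t - s)\<^sup>2 \<le> p * (p + 1) * (1 / b powr (p + 2)) / 2 * (t - s)\<^sup>2"
    using p by (intro mult_right_mono divide_right_mono mult_left_mono) auto
  then show ?thesis
    using \<xi>(2) by (simp add: diff_def numeral_2_eq_2)
qed

text \<open>\<open>transpose Q ** R\<close> is orthogonal, so its squared entries sum to 1 along
  rows and columns. A sum over one spectrum can thus be combined with mixed terms under a single
  double sum.\<close>

lemma double_stochastic_sums:
  fixes Q R :: "real^'k^'k"
  assumes Q: "orthogonal_matrix Q" and R: "orthogonal_matrix R"
  shows "(\<Sum>k\<in>UNIV. \<Sum>l\<in>UNIV. a $ k * ((transpose Q ** R) $ k $ l)\<^sup>2) = (\<Sum>k\<in>UNIV. a $ k)"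
    and "(\<Sum>k\<in>UNIV. \<Sum>l\<in>UNIV. a $ l * ((transpose Q ** R) $ k $ l)\<^sup>2) = (\<Sum>l\<in>UNIV. a $ l)"
proof -
  have S: "orthogonal_matrix (transpose Q ** R)"
    using Q R by (simp add: orthogonal_matrix_mul)
  show "(\<Sum>k\<in>UNIV. \<Sum>l\<in>UNIV. a $ k * ((transpose Q ** R) $ k $ l)\<^sup>2) = (\<Sum>k\<in>UNIV. a $ k)"
    by (simp add: orthogonal_matrix_row_sum_squares[OF S] flip: sum_distrib_left)
  show "(\<Sum>k\<in>UNIV. \<Sum>l\<in>UNIV. a $ l * ((transpose Q ** R) $ k $ l)\<^sup>2) = (\<Sum>l\<in>UNIV. a $ l)"
    by (subst sum.swap) (simp add: orthogonal_matrix_column_sum_squares[OF S] flip: sum_distrib_left)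
qed

text \<open>The matrix paired with \<open>Y - X\<close> in \<open>E\<close> is the gradient of
  \<open>ln \<circ> \<phi>\<close> at \<open>X\<close>. In the upper bound, \<open>b\<close>
  controls the second derivative of the power and \<open>c\<close> bounds \<open>\<phi> X\<close>
  from below.\<close>

lemma ln_trace_powr_bounds:
  fixes X Y :: "real^'k^'k" and b c p :: real
  assumes "transpose X = X" "transpose Y = Y" and p: "p > 0" and b: "b > 0"
    and X_bounds: "\<And>w. b * (norm w)\<^sup>2 \<le> w \<bullet> (X *v w)" "\<And>w. w \<bullet> (X *v w) \<le> c * (norm w)\<^sup>2"
    and Y_bounds: "\<And>w. b * (norm w)\<^sup>2 \<le> w \<bullet> (Y *v w)" "\<And>w. w \<bullet> (Y *v w) \<le> c * (norm w)\<^sup>2"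
  defines "\<phi> \<equiv> \<lambda>X :: real^'k^'k. trace (mat_powr X (- p))"
  defines "E \<equiv> ln (\<phi> Y) - ln (\<phi> X) - ((- p / \<phi> X) *\<^sub>R mat_powr X (- p - 1)) \<bullet> (Y - X)"
  shows "0 \<le> E"
    and "E \<le> c powr p / real CARD('k) * (p * (p + 1) / b powr (p + 2)) / 2 * (norm (Y - X))\<^sup>2"
proof -
  obtain Q d where Q: "orthogonal_matrix Q" and X: "X = Q ** diag d ** transpose Q"
    and d: "\<And>k. b \<le> d $ k" "\<And>k. d $ k \<le> c"
    using bounded_symmetric_matrix_diagonalization[OF assms(1) X_bounds] by blast
  obtain R e where R: "orthogonal_matrix R" and Y: "Y = R ** diag e ** transpose R"
    and e: "\<And>k. b \<le> e $ k" "\<And>k. e $ k \<le> c"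
    using bounded_symmetric_matrix_diagonalization[OF assms(2) Y_bounds] by blast
  have pos: "d $ k > 0" "e $ k > 0" for k
    using d[of k] e[of k] b by auto
  have nz: "d $ k \<noteq> 0" "e $ k \<noteq> 0" for k
    using pos[of k] by auto
  have "c > 0" using pos(1) d(2) by (meson less_le_trans)
  define W where "W k l = ((transpose Q ** R) $ k $ l)\<^sup>2" for k l
  have W0: "W k l \<ge> 0" for k l by (simp add: W_def)
  let ?S = "\<lambda>f. \<Sum>k\<in>UNIV. \<Sum>l\<in>UNIV. f k l * W k l"
  note W_sums = double_stochastic_sums[OF Q R, folded W_def]
  have \<phi>X: "\<phi> X = ?S (\<lambda>k l. d $ k powr (- p))" "\<phi> X = (\<Sum>k\<in>UNIV. d $ k powr (- p))"
    using W_sums(1)[of "\<chi> k. d $ k powr (- p)"]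
    by (simp_all add: \<phi>_def X mat_powr_conjugated_diag Q pos trace_conjugated_diag)
  have \<phi>Y: "\<phi> Y = ?S (\<lambda>k l. e $ l powr (- p))" "\<phi> Y = (\<Sum>k\<in>UNIV. e $ k powr (- p))"
    using W_sums(2)[of "\<chi> k. e $ k powr (- p)"]
    by (simp_all add: \<phi>_def Y mat_powr_conjugated_diag R pos trace_conjugated_diag)
  have \<phi>_pos: "\<phi> X > 0" "\<phi> Y > 0"
    unfolding \<phi>X(2) \<phi>Y(2) by (rule sum_pos; simp add: nz)+
  have \<phi>X_ge: "real CARD('k) / c powr p \<le> \<phi> X"
  proof -
    have "(\<Sum>k\<in>(UNIV :: 'k set). c powr (- p)) \<le> \<phi> X"
      unfolding \<phi>X(2) using d pos p by (intro sum_mono powr_mono2') auto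
    then show ?thesis by (simp add: powr_minus divide_inverse)
  qed
  \<comment> \<open>With \<open>R = Q\<close> the weights form the identity matrix; the row sums of
    \<open>W\<close> then reinsert the second index.\<close>
  have XX: "(Q ** diag a ** transpose Q) \<bullet> X = ?S (\<lambda>k l. a $ k * d $ k)" for a
  proof -
    have "(Q ** diag a ** transpose Q) \<bullet> X = (\<Sum>k\<in>UNIV. a $ k * d $ k)"
      unfolding X inner_conjugated_diag using Q
      by (simp add: orthogonal_matrix_def mat_def if_distrib[of "\<lambda>x. x\<^sup>2"] if_distrib[of "(*) _"] cong: if_cong)
    then show ?thesis
      using W_sums(1)[of "\<chi> k. a $ k * d $ k"] by simp
  qed
  have XY: "(Q ** diag a ** transpose Q) \<bullet> Y = ?S (\<lambda>k l. a $ k * e $ l)" for a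
    unfolding Y inner_conjugated_diag W_def ..
  have YY: "Y \<bullet> Y = ?S (\<lambda>k l. e $ l * e $ l)"
  proof -
    have "Y \<bullet> Y = (\<Sum>k\<in>UNIV. e $ k * e $ k)"
      unfolding Y inner_conjugated_diag using R
      by (simp add: orthogonal_matrix_def mat_def if_distrib[of "\<lambda>x. x\<^sup>2"] if_distrib[of "(*) _"] cong: if_cong)
    then show ?thesis
      using W_sums(2)[of "\<chi> k. e $ k * e $ k"] by simp
  qed
  have dist: "(norm (Y - X))\<^sup>2 = ?S (\<lambda>k l. (e $ l - d $ k)\<^sup>2)"
  proof -
    have "(norm (Y - X))\<^sup>2 = Y \<bullet> Y - 2 * (X \<bullet> Y) + X \<bullet> X"
      by (simp add: power2_norm_eq_inner inner_diff inner_commute)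
    also have "X \<bullet> Y = ?S (\<lambda>k l. d $ k * e $ l)"
      using XY[of d] by (simp flip: X)
    also have "X \<bullet> X = ?S (\<lambda>k l. d $ k * d $ k)"
      using XX[of d] by (simp flip: X)
    finally show ?thesis
      unfolding YY by (simp add: sum_distrib_left power2_eq_square algebra_simps
          flip: sum.distrib sum_subtractf)
  qed
  define D where "D = ?S (\<lambda>k l. d $ k powr (- p - 1) * (e $ l - d $ k))"
  have FD: "mat_powr X (- p - 1) \<bullet> (Y - X) = D"
  proof -
    have F: "mat_powr X (- p - 1) = Q ** diag (\<chi> k. d $ k powr (- p - 1)) ** transpose Q"
      unfolding X using Q pos(1) by (rule mat_powr_conjugated_diag)
    show ?thesis
      unfolding F inner_diff_right XX XY D_def
      by (simp add: algebra_simps flip: sum_subtractf)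
  qed
  have E: "E = ln (\<phi> Y / \<phi> X) + p * D / \<phi> X"
    using \<phi>_pos by (simp add: E_def FD ln_div)
  define \<rho> where "\<rho> = \<phi> Y / \<phi> X"
  have \<rho>: "\<rho> > 0" using \<phi>_pos by (simp add: \<rho>_def)
  \<comment> \<open>Jensen's inequality for \<open>ln\<close> with the weights \<open>d\<^sub>k\<^bsup>-p\<^esup> W\<^sub>k\<^sub>l / \<phi> X\<close> gives convexity of \<open>ln \<circ> \<phi>\<close>.\<close>
  have "- p * (d $ k powr (- p - 1) * (e $ l - d $ k))
      \<le> e $ l powr (- p) / \<rho> - d $ k powr (- p) + d $ k powr (- p) * ln \<rho>" for k l
  proof -
    \<comment> \<open>Divided by \<open>d $ k powr (- p)\<close>, the claim involves only this
      ratio. It follows from \<open>ln y \<le> y - 1\<close> used twice, at \<open>y = x\<close> and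
      at \<open>y = x powr (- p) / \<rho>\<close>.\<close>
    define x where "x = e $ l / d $ k"
    have x: "x > 0" using pos by (simp add: x_def)
    have "- p * (x - 1) \<le> - p * ln x"
      using p x by (simp add: ln_le_minus_one)
    also have "\<dots> = ln (x powr (- p) / \<rho>) + ln \<rho>"
      using x \<rho> by (simp add: ln_div ln_powr)
    also have "\<dots> \<le> x powr (- p) / \<rho> - 1 + ln \<rho>"
      using x \<rho> by (intro add_right_mono ln_le_minus_one) simp
    finally have le: "d $ k powr (- p) * (- p * (x - 1)) \<le> d $ k powr (- p) * (x powr (- p) / \<rho> - 1 + ln \<rho>)"
      by (rule mult_left_mono) simp
    have e_powr: "d $ k powr (- p) * x powr (- p) = e $ l powr (- p)"
      using pos[of k] pos[of l] by (simp add: x_def powr_divide)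
    have "d $ k powr (- p - 1) * (e $ l - d $ k) = d $ k powr (- p) * (x - 1)"
      using pos[of k] by (simp add: x_def powr_diff field_simps)
    then have "- p * (d $ k powr (- p - 1) * (e $ l - d $ k)) = d $ k powr (- p) * (- p * (x - 1))"
      by (simp only: mult_ac)
    then show ?thesis
      using le unfolding e_powr[symmetric] by (simp add: algebra_simps)
  qed
  then have "?S (\<lambda>k l. - p * (d $ k powr (- p - 1) * (e $ l - d $ k)))
      \<le> ?S (\<lambda>k l. e $ l powr (- p) / \<rho> - d $ k powr (- p) + d $ k powr (- p) * ln \<rho>)"
    by (intro sum_mono mult_right_mono W0)
  also have "\<dots> = \<phi> Y / \<rho> - \<phi> X + \<phi> X * ln \<rho>"
    unfolding \<phi>X(1) \<phi>Y(1)
    by (simp add: sum_divide_distrib sum_distrib_left sum_distrib_right algebra_simps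
        flip: sum.distrib sum_subtractf)
  \<comment> \<open>This choice of \<open>\<rho>\<close> makes the non-logarithmic terms cancel
    after summation.\<close>
  also have "\<phi> Y / \<rho> = \<phi> X" using \<phi>_pos by (simp add: \<rho>_def)
  also have "?S (\<lambda>k l. - p * (d $ k powr (- p - 1) * (e $ l - d $ k))) = - p * D"
    by (simp add: D_def sum_distrib_left mult_ac sum_negf)
  finally have "- p * D \<le> \<phi> X * ln \<rho>" by simp
  then show "0 \<le> E"
    using \<phi>_pos by (simp add: E flip: \<rho>_def) (simp add: field_simps)
  define K where "K = p * (p + 1) / b powr (p + 2)"
  have "K \<ge> 0" using p by (simp add: K_def)
  have "?S (\<lambda>k l. e $ l powr (- p) - d $ k powr (- p) + p * d $ k powr (- p - 1) * (e $ l - d $ k))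
      \<le> ?S (\<lambda>k l. K / 2 * (e $ l - d $ k)\<^sup>2)"
    unfolding K_def by (intro sum_mono mult_right_mono W0 powr_minus_Taylor_upper p b d e)
  also have "\<dots> = K / 2 * (norm (Y - X))\<^sup>2"
    unfolding dist by (simp add: sum_distrib_left mult_ac)
  also have "?S (\<lambda>k l. e $ l powr (- p) - d $ k powr (- p) + p * d $ k powr (- p - 1) * (e $ l - d $ k))
      = \<phi> Y - \<phi> X + p * D"
    unfolding \<phi>X(1) \<phi>Y(1) D_def
    by (simp add: sum_distrib_left algebra_simps flip: sum.distrib sum_subtractf)
  finally have upper: "\<phi> Y - \<phi> X + p * D \<le> K / 2 * (norm (Y - X))\<^sup>2" .
  \<comment> \<open>The bound \<open>ln r \<le> r - 1\<close> at
    \<open>r = \<phi> Y / \<phi> X\<close> reduces the error for \<open>ln \<circ> \<phi>\<close> to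
    the error for \<open>\<phi>\<close>, divided by \<open>\<phi> X\<close>.\<close>
  have "E \<le> (\<phi> Y / \<phi> X - 1) + p * D / \<phi> X"
    unfolding E using \<phi>_pos by (simp add: ln_le_minus_one)
  also have "\<dots> = (\<phi> Y - \<phi> X + p * D) / \<phi> X"
    using \<phi>_pos by (simp add: field_simps)
  also have "\<dots> \<le> K / 2 * (norm (Y - X))\<^sup>2 / \<phi> X"
    using upper \<phi>_pos by (intro divide_right_mono) auto
  also have "\<dots> \<le> K / 2 * (norm (Y - X))\<^sup>2 / (real CARD('k) / c powr p)"
    using \<phi>X_ge \<open>c > 0\<close> \<open>K \<ge> 0\<close> by (intro divide_left_mono mult_pos_pos \<phi>_pos) auto
  finally show "E \<le> c powr p / real CARD('k) * (p * (p + 1) / b powr (p + 2)) / 2 * (norm (Y - X))\<^sup>2"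
    by (simp add: K_def field_simps)
qed

subsection \<open>Smoothness from quadratic bounds\<close>

text \<open>
  Comparing \<open>f\<close> at \<open>c + d\<close> and \<open>c - d\<close>, with \<open>c\<close> the midpoint of \<open>x\<close> and \<open>y\<close> and \<open>d\<close> parallel
  to \<open>g y - g x\<close> of length \<open>norm (y - x) / 2\<close>, from both \<open>x\<close> and \<open>y\<close> isolates \<open>(g y - g x) \<bullet> d\<close>.
\<close>

lemma gradient_diff_bound_of_quadratic_bound:
  fixes f :: "'a::real_inner \<Rightarrow> real"
  assumes quad: "\<And>z w. z \<in> U \<Longrightarrow> w \<in> U \<Longrightarrow> \<bar>f w - f z - g z \<bullet> (w - z)\<bar> \<le> M / 2 * (norm (w - z))\<^sup>2"
    and U: "cball (midpoint x y) (norm (x - y) / 2) \<subseteq> U"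
  shows "norm (g x - g y) \<le> M * norm (x - y)"
proof (cases "x = y \<or> g x = g y")
  case True
  \<comment> \<open>The sign of \<open>M\<close> is not assumed; the quadratic bound between the
    endpoints forces it.\<close>
  moreover have "0 \<le> M * norm (x - y)" if "x \<noteq> y"
  proof -
    have "x \<in> U" "y \<in> U"
      by (rule subsetD[OF U]; simp add: dist_midpoint; simp add: dist_norm)+
    then have "0 \<le> M / 2 * (norm (y - x))\<^sup>2"
      using quad[of x y] by linarith
    then show ?thesis using that by (simp add: zero_le_mult_iff)
  qed
  ultimately show ?thesis by fastforce
next
  case False
  define c where "c = midpoint x y"
  define h where "h = (1/2) *\<^sub>R (y - x)"
  define u where "u = g y - g x"
  define d where "d = (norm h / norm u) *\<^sub>R u"
  have xy: "x = c - h" "y = c + h"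
    by (auto simp: c_def h_def midpoint_def algebra_simps simp flip: scaleR_2 scaleR_add_left)
  have hn: "norm h = norm (x - y) / 2" by (simp add: h_def norm_minus_commute)
  have u0: "u \<noteq> 0" and h0: "norm h > 0" using False by (auto simp: u_def h_def)
  have dn: "norm d = norm h" using u0 by (simp add: d_def)
  have in_U: "c - h \<in> U" "c + h \<in> U" "c + d \<in> U" "c - d \<in> U"
    by (rule subsetD[OF U]; simp add: c_def[symmetric] dist_norm dn hn)+
  \<comment> \<open>Upper estimates are taken along \<open>h + d\<close> and lower ones along
    \<open>h - d\<close>. In the sum of the four all values of \<open>f\<close> cancel, and the
    parallelogram law evaluates the right-hand side.\<close>
  have "f (c + d) - f (c - h) - g (c - h) \<bullet> (h + d) \<le> M / 2 * (norm (h + d))\<^sup>2"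
    using abs_le_D1[OF quad[OF in_U(1,3)]] by (simp add: algebra_simps)
  moreover have "- (f (c + d) - f (c + h) - g (c + h) \<bullet> (d - h)) \<le> M / 2 * (norm (h - d))\<^sup>2"
    using abs_le_D2[OF quad[OF in_U(2,3)]] by (simp add: algebra_simps norm_minus_commute)
  moreover have "f (c - d) - f (c + h) + g (c + h) \<bullet> (h + d) \<le> M / 2 * (norm (h + d))\<^sup>2"
    using abs_le_D1[OF quad[OF in_U(2,4)]] norm_minus_cancel[of "h + d"]
    by (simp add: inner_diff_right inner_add_right algebra_simps del: norm_minus_cancel)
  moreover have "- (f (c - d) - f (c - h) - g (c - h) \<bullet> (h - d)) \<le> M / 2 * (norm (h - d))\<^sup>2"
    using abs_le_D2[OF quad[OF in_U(1,4)]] by (simp add: algebra_simps)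
  ultimately have "2 * ((g (c + h) - g (c - h)) \<bullet> d) \<le> M * ((norm (h + d))\<^sup>2 + (norm (h - d))\<^sup>2)"
    by (simp add: inner_diff inner_add algebra_simps)
  also have "(norm (h + d))\<^sup>2 + (norm (h - d))\<^sup>2 = 4 * (norm h)\<^sup>2"
    using dn by (simp add: power2_norm_eq_inner inner_diff inner_add inner_commute norm_eq)
  also have "(g (c + h) - g (c - h)) \<bullet> d = norm h * norm u"
    using u0 by (simp add: d_def u_def xy dot_square_norm power2_eq_square)
  finally have "norm h * norm u \<le> norm h * (2 * M * norm h)"
    by (simp add: power2_eq_square algebra_simps)
  then have "norm u \<le> 2 * M * norm h"
    using h0 by (simp only: mult_le_cancel_left_pos)
  then show ?thesis
    by (simp add: u_def hn norm_minus_commute)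
qed

text \<open>Cut the segment into \<open>Suc n\<close> equal pieces of length
  \<open>D / Suc n\<close>. The local bounds add up to \<open>K (D / Suc n) * D\<close>, which tends
  to \<open>L * D\<close>.\<close>

lemma lipschitz_of_local_bound:
  fixes g :: "'a::real_normed_vector \<Rightarrow> 'b::real_normed_vector"
  assumes S: "convex S" and \<delta>: "\<delta> > 0"
    and local: "\<And>x y. x \<in> S \<Longrightarrow> y \<in> S \<Longrightarrow> norm (x - y) < \<delta> \<Longrightarrow> norm (g x - g y) \<le> K (norm (x - y)) * norm (x - y)"
    and K: "(K \<longlongrightarrow> L) (at_right 0)"
    and xy: "x \<in> S" "y \<in> S"
  shows "norm (g x - g y) \<le> L * norm (x - y)"
proof (cases "x = y")
  case True
  then show ?thesis by simp
next
  case False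
  define D where "D = norm (x - y)"
  have D: "D > 0" using False by (simp add: D_def)
  have lim0: "(\<lambda>n. D / real (Suc n)) \<longlonglongrightarrow> 0"
    by (intro real_tendsto_divide_at_top[OF tendsto_const])
      (intro filterlim_compose[OF filterlim_real_sequentially] filterlim_Suc)
  have "filterlim (\<lambda>n. D / real (Suc n)) (at_right 0) sequentially"
    unfolding filterlim_at using lim0 D by (auto simp del: of_nat_Suc)
  then have "(\<lambda>n. K (D / real (Suc n)) * D) \<longlonglongrightarrow> L * D"
    by (intro tendsto_mult_right filterlim_compose[OF K])
  moreover have "eventually (\<lambda>n. D / real (Suc n) < \<delta>) sequentially"
    using lim0 \<delta> by (rule order_tendstoD)
  then have "eventually (\<lambda>n. norm (g x - g y) \<le> K (D / real (Suc n)) * D) sequentially"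
  proof eventually_elim
    case (elim n)
    define m where "m = Suc n"
    define z where "z = (\<lambda>i. x + (real i / real m) *\<^sub>R (y - x))"
    have m: "m > 0" by (simp add: m_def)
    have zS: "z i \<in> S" if "i \<le> m" for i
    proof -
      have "z i = (1 - real i / real m) *\<^sub>R x + (real i / real m) *\<^sub>R y"
        by (simp add: z_def algebra_simps)
      then show ?thesis
        using convexD_alt[OF S xy, of "real i / real m"] that m by simp
    qed
    have step: "norm (z i - z (Suc i)) = D / real m" for i
    proof -
      have "z i - z (Suc i) = (1 / real m) *\<^sub>R (x - y)"
        by (simp add: z_def algebra_simps add_divide_distrib)
      then show ?thesis by (simp add: D_def)
    qed
    have "norm (g x - g y) = norm (\<Sum>i<m. g (z i) - g (z (Suc i)))"
      using m sum_lessThan_telescope'[of "\<lambda>i. g (z i)" m] by (simp add: z_def)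
    also have "\<dots> \<le> (\<Sum>i<m. K (D / real m) * (D / real m))"
    proof (rule sum_norm_le)
      fix i assume "i \<in> {..<m}"
      then show "norm (g (z i) - g (z (Suc i))) \<le> K (D / real m) * (D / real m)"
        using local[of "z i" "z (Suc i)"] zS[of i] zS[of "Suc i"] elim by (simp add: step m_def)
    qed
    also have "\<dots> = K (D / real m) * D" using m by simp
    finally show ?case by (simp add: m_def)
  qed
  ultimately show ?thesis
    unfolding D_def[symmetric] by (intro tendsto_lowerbound) auto
qed

text \<open>Divided by \<open>norm (y - x)\<close>, a quadratic remainder still tends to 0.\<close>

lemma GDERIV_of_quadratic_bound:
  fixes f :: "'a::real_inner \<Rightarrow> real"
  assumes "r > 0" and quad: "\<And>y. norm (y - x) < r \<Longrightarrow> \<bar>f y - f x - D \<bullet> (y - x)\<bar> \<le> M * (norm (y - x))\<^sup>2"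
  shows "GDERIV f x :> D"
  unfolding gderiv_def has_derivative_at_within
proof (intro conjI)
  show "bounded_linear (\<lambda>h. h \<bullet> D)" by (rule bounded_linear_inner_left)
  have "((\<lambda>y. norm (M * norm (y - x))) \<longlongrightarrow> 0) (at x)"
    by (auto intro!: tendsto_eq_intros)
  then show "((\<lambda>y. (f y - f x - (y - x) \<bullet> D) /\<^sub>R norm (y - x)) \<longlongrightarrow> 0) (at x)"
  proof (rule tendsto_0_le[where K = 1])
    have "eventually (\<lambda>y. y \<in> ball x r) (at x)"
      using eventually_at_ball[OF \<open>r > 0\<close>, of x UNIV] by simp
    then show "\<forall>\<^sub>F y in at x. norm ((f y - f x - (y - x) \<bullet> D) /\<^sub>R norm (y - x)) \<le> norm (norm (M * norm (y - x))) * 1"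
    proof eventually_elim
      case (elim y)
      then have "\<bar>f y - f x - D \<bullet> (y - x)\<bar> \<le> M * (norm (y - x))\<^sup>2"
        by (intro quad) (simp add: dist_norm norm_minus_commute)
      also have "\<dots> \<le> \<bar>M\<bar> * (norm (y - x))\<^sup>2" by (intro mult_right_mono) auto
      finally show ?case
        by (cases "y = x") (simp_all add: inner_commute abs_mult divide_simps power2_eq_square mult_ac)
    qed
  qed
qed

subsection \<open>Weighted Gram matrices and the Fusion information matrix\<close>

text \<open>The shifts by the lower bounds in \<open>X_mat\<close> cancel, so
  \<open>X_mat A l x\<close> is this matrix, and \<open>C_mat A l\<close> is its value at
  \<open>real_vec l\<close>.\<close>

definition weighted_gram :: "real^'n^'m \<Rightarrow> real^'m \<Rightarrow> real^'n^'n" where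
  "weighted_gram A x = transpose A ** diag x ** A"

lemma weighted_gram_component:
  "weighted_gram A x $ i $ j = (\<Sum>k\<in>UNIV. x $ k * A $ k $ i * A $ k $ j)"
  by (simp add: weighted_gram_def matrix_matrix_mult_def diag_def transpose_def
      if_distrib[of "(*) _"] cong: if_cong) (simp add: mult_ac)

lemma weighted_gram_diff: "weighted_gram A (x - y) = weighted_gram A x - weighted_gram A y"
  by (simp add: vec_eq_iff weighted_gram_component left_diff_distrib sum_subtractf)

lemma X_mat_eq_weighted_gram: "X_mat A l x = weighted_gram A x"
  using weighted_gram_diff[of A x "real_vec l"]
  by (simp add: X_mat_def C_mat_def weighted_gram_def)

lemma transpose_weighted_gram: "transpose (weighted_gram A x) = weighted_gram A x"
  by (simp add: vec_eq_iff transpose_def weighted_gram_component mult_ac)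

text \<open>Computes the adjoint of the linear map \<open>weighted_gram A\<close>, which turns a
  gradient in matrix space into one in \<open>x\<close>.\<close>

lemma inner_weighted_gram:
  "G \<bullet> weighted_gram A h = (\<chi> i. row i A \<bullet> (G *v row i A)) \<bullet> h"
proof -
  have "G \<bullet> weighted_gram A h
      = (\<Sum>i\<in>UNIV. \<Sum>j\<in>UNIV. \<Sum>k\<in>UNIV. G $ i $ j * (h $ k * A $ k $ i * A $ k $ j))"
    by (simp add: inner_vec_def weighted_gram_component sum_distrib_left)
  also have "\<dots> = (\<Sum>i\<in>UNIV. \<Sum>k\<in>UNIV. \<Sum>j\<in>UNIV. G $ i $ j * (h $ k * A $ k $ i * A $ k $ j))"
    by (intro sum.cong refl sum.swap)
  also have "\<dots> = (\<Sum>k\<in>UNIV. \<Sum>i\<in>UNIV. \<Sum>j\<in>UNIV. G $ i $ j * (h $ k * A $ k $ i * A $ k $ j))"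
    by (rule sum.swap)
  also have "\<dots> = (\<chi> i. row i A \<bullet> (G *v row i A)) \<bullet> h"
    by (simp add: inner_vec_def matrix_vector_mult_def row_def sum_distrib_left sum_distrib_right mult_ac)
  finally show ?thesis .
qed

lemma weighted_gram_quadratic_form:
  "w \<bullet> (weighted_gram A x *v w) = (\<Sum>i\<in>UNIV. x $ i * (row i A \<bullet> w)\<^sup>2)"
proof -
  have "weighted_gram A x *v w = transpose A *v (diag x *v (A *v w))"
    by (simp only: weighted_gram_def matrix_vector_mul_assoc matrix_mul_assoc)
  then have "w \<bullet> (weighted_gram A x *v w) = (diag x *v (A *v w)) \<bullet> (A *v w)"
    by (metis dot_lmul_matrix inner_commute transpose_matrix_vector)
  then show ?thesis
    by (simp add: diag_mult_vec) (simp add: inner_vec_def matrix_vector_mult_def row_def power2_eq_square mult_ac)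
qed

section \<open>Norm estimates for weighted Gram matrices\<close>

lemma spectral_norm_nonneg: "0 \<le> spectral_norm A"
  unfolding spectral_norm_def by (intro onorm_pos_le matrix_vector_mul_bounded_linear)

text \<open>Duality: pairing \<open>transpose A *v v\<close> with itself moves \<open>A\<close> to
  the other side, where \<open>onorm\<close> applies.\<close>

lemma norm_transpose_mult_le: "norm (transpose A *v v) \<le> spectral_norm A * norm v"
proof (cases "transpose A *v v = 0")
  case True
  then show ?thesis using spectral_norm_nonneg[of A] by simp
next
  case False
  define u where "u = transpose A *v v"
  have "norm u * norm u = u \<bullet> (transpose A *v v)"
    by (simp add: u_def dot_square_norm power2_eq_square)
  also have "\<dots> = (A *v u) \<bullet> v"
    by (metis dot_lmul_matrix inner_commute transpose_matrix_vector)
  also have "\<dots> \<le> norm (A *v u) * norm v"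
    by (rule norm_cauchy_schwarz)
  also have "\<dots> \<le> (spectral_norm A * norm u) * norm v"
    unfolding spectral_norm_def by (intro mult_right_mono onorm matrix_vector_mul_bounded_linear) simp
  finally have "norm u * norm u \<le> norm u * (spectral_norm A * norm v)"
    by (simp add: mult_ac)
  then show ?thesis
    using False by (simp add: u_def)
qed

lemma gram_diagonal: "(A ** transpose A) $ i $ i = (norm (row i A))\<^sup>2"
  by (simp add: matrix_mult_transpose_dot_row power2_norm_eq_inner)

text \<open>Row \<open>j\<close> of the matrix is \<open>transpose A\<close> applied to column
  \<open>j\<close> of \<open>A\<close> scaled entrywise by \<open>h\<close>. The spectral norm
  bounds this application; the scaled columns together contribute the squared row norms of
  \<open>A\<close> weighted by the squares of \<open>h\<close>.\<close>

lemma norm_weighted_gram_le: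
  fixes A :: "real^'n^'m"
  shows "(norm (weighted_gram A h))\<^sup>2
    \<le> (MAX i. (A ** transpose A) $ i $ i) * (spectral_norm A)\<^sup>2 * (norm h)\<^sup>2"
proof -
  let ?R = "MAX i. (A ** transpose A) $ i $ i"
  have "(norm (weighted_gram A h))\<^sup>2 = (\<Sum>j\<in>UNIV. (norm (transpose A *v (\<chi> k. h $ k * A $ k $ j)))\<^sup>2)"
  proof -
    have "transpose A *v (\<chi> k. h $ k * A $ k $ j) = weighted_gram A h $ j" for j
      by (simp add: vec_eq_iff weighted_gram_component vector_matrix_mult_def mult_ac)
    then show ?thesis
      by (simp only: power2_norm_eq_inner inner_vec_def[of "weighted_gram A h"])
  qed
  also have "\<dots> \<le> (\<Sum>j\<in>UNIV. (spectral_norm A * norm (\<chi> k. h $ k * A $ k $ j))\<^sup>2)"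
    by (intro sum_mono power_mono norm_transpose_mult_le norm_ge_zero)
  also have "\<dots> = (spectral_norm A)\<^sup>2 * (\<Sum>j\<in>UNIV. \<Sum>k\<in>UNIV. (h $ k)\<^sup>2 * (A $ k $ j)\<^sup>2)"
    unfolding power_mult_distrib sum_distrib_left[symmetric]
    by (simp add: power2_norm_eq_inner inner_vec_def power_mult_distrib flip: power2_eq_square)
  also have "(\<Sum>j\<in>UNIV. \<Sum>k\<in>UNIV. (h $ k)\<^sup>2 * (A $ k $ j)\<^sup>2) = (\<Sum>k\<in>UNIV. (h $ k)\<^sup>2 * (A ** transpose A) $ k $ k)"
    by (subst sum.swap)
      (simp add: gram_diagonal power2_norm_eq_inner inner_vec_def row_def sum_distrib_left flip: power2_eq_square)
  also have "\<dots> \<le> (\<Sum>k\<in>UNIV. (h $ k)\<^sup>2 * ?R)"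
    by (intro sum_mono mult_left_mono Max_ge) auto
  also have "\<dots> = ?R * (norm h)\<^sup>2"
    unfolding sum_distrib_right[symmetric]
    by (simp add: power2_norm_eq_inner inner_vec_def mult.commute flip: power2_eq_square)
  finally show ?thesis
    by (simp add: mult_right_mono mult_ac)
qed

text \<open>Eigenvalue bounds are stated through the quadratic form because it is linear in
  \<open>x\<close>, which makes perturbation estimates immediate.\<close>

definition spectrum_within :: "real^'n^'m \<Rightarrow> real \<Rightarrow> real \<Rightarrow> (real^'m) set" where
  "spectrum_within A b c = {x. \<forall>w. b * (norm w)\<^sup>2 \<le> w \<bullet> (weighted_gram A x *v w) \<and>
     w \<bullet> (weighted_gram A x *v w) \<le> c * (norm w)\<^sup>2}"

text \<open>By Cauchy-Schwarz each weight change of size at most \<open>r\<close> moves the form by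
  at most \<open>r\<close> times a squared row norm; \<open>\<beta>\<close> is the squared Frobenius
  norm of \<open>A\<close>.\<close>

lemma spectrum_within_perturb:
  fixes A :: "real^'n^'m"
  assumes x: "x \<in> spectrum_within A b c" and y: "norm (y - x) \<le> r"
  defines "\<beta> \<equiv> \<Sum>i\<in>UNIV. (norm (row i A))\<^sup>2"
  shows "y \<in> spectrum_within A (b - \<beta> * r) (c + \<beta> * r)"
proof -
  have "\<bar>w \<bullet> (weighted_gram A y *v w) - w \<bullet> (weighted_gram A x *v w)\<bar> \<le> \<beta> * r * (norm w)\<^sup>2" for w
  proof -
    have "\<bar>w \<bullet> (weighted_gram A y *v w) - w \<bullet> (weighted_gram A x *v w)\<bar>
        = \<bar>\<Sum>i\<in>UNIV. (y - x) $ i * (row i A \<bullet> w)\<^sup>2\<bar>"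
      by (simp add: weighted_gram_quadratic_form left_diff_distrib sum_subtractf)
    also have "\<dots> \<le> (\<Sum>i\<in>UNIV. r * ((norm (row i A))\<^sup>2 * (norm w)\<^sup>2))"
    proof (intro sum_abs[THEN order_trans] sum_mono)
      fix i
      have "(row i A \<bullet> w)\<^sup>2 \<le> (norm (row i A))\<^sup>2 * (norm w)\<^sup>2"
        by (metis Cauchy_Schwarz_ineq power2_norm_eq_inner)
      moreover have "\<bar>(y - x) $ i\<bar> \<le> r"
        using component_le_norm_cart[of "y - x" i] y by linarith
      ultimately show "\<bar>(y - x) $ i * (row i A \<bullet> w)\<^sup>2\<bar> \<le> r * ((norm (row i A))\<^sup>2 * (norm w)\<^sup>2)"
        unfolding abs_mult by (intro mult_mono) auto
    qed
    also have "\<dots> = \<beta> * r * (norm w)\<^sup>2"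
      by (simp add: \<beta>_def sum_distrib_left sum_distrib_right mult_ac)
    finally show ?thesis .
  qed
  then show ?thesis
    using x unfolding spectrum_within_def
    by (simp add: abs_le_iff left_diff_distrib distrib_right) (smt (verit, best))
qed

text \<open>The chain rule: the gradient of \<open>ln \<circ> \<phi>\<close> at
  \<open>X_mat A l x\<close>, carried back by the adjoint of \<open>weighted_gram A\<close>.\<close>

definition k_F_grad :: "real^'n^'m \<Rightarrow> nat^'m \<Rightarrow> real \<Rightarrow> real^'m \<Rightarrow> real^'m" where
  "k_F_grad A l p x = (\<chi> i. row i A \<bullet> (((- p / trace (mat_powr (X_mat A l x) (- p))) *\<^sub>R
     mat_powr (X_mat A l x) (- p - 1)) *v row i A))"

lemma k_F_quadratic_bounds:
  fixes A :: "real^'n^'m"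
  assumes p: "p > 0" and b: "b > 0"
    and x: "x \<in> spectrum_within A b c" and y: "y \<in> spectrum_within A b c"
  shows "\<bar>k_F A l p y - k_F A l p x - k_F_grad A l p x \<bullet> (y - x)\<bar>
    \<le> (c powr p / real CARD('n) * p * (p + 1) * (MAX i. (A ** transpose A) $ i $ i) *
        ((spectral_norm A)\<^sup>2 / b powr (2 + p))) / 2 * (norm (y - x))\<^sup>2"
proof -
  let ?B = "(MAX i. (A ** transpose A) $ i $ i) * (spectral_norm A)\<^sup>2"
  let ?M = "c powr p / real CARD('n) * (p * (p + 1) / b powr (p + 2)) / 2"
  let ?E = "k_F A l p y - k_F A l p x - k_F_grad A l p x \<bullet> (y - x)"
  have grad: "k_F_grad A l p x \<bullet> (y - x) = ((- p / trace (mat_powr (weighted_gram A x) (- p))) *\<^sub>R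
     mat_powr (weighted_gram A x) (- p - 1)) \<bullet> (weighted_gram A y - weighted_gram A x)"
    unfolding weighted_gram_diff[symmetric] inner_weighted_gram
    by (simp add: k_F_grad_def X_mat_eq_weighted_gram)
  have x': "b * (norm w)\<^sup>2 \<le> w \<bullet> (weighted_gram A x *v w)" "w \<bullet> (weighted_gram A x *v w) \<le> c * (norm w)\<^sup>2"
    and y': "b * (norm w)\<^sup>2 \<le> w \<bullet> (weighted_gram A y *v w)" "w \<bullet> (weighted_gram A y *v w) \<le> c * (norm w)\<^sup>2" for w
    using x y by (auto simp: spectrum_within_def)
  note B = ln_trace_powr_bounds[OF transpose_weighted_gram transpose_weighted_gram p b x' y']
  have "0 \<le> ?E"
    using B(1) unfolding k_F_def grad X_mat_eq_weighted_gram by simp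
  moreover have "?E \<le> ?M * (norm (weighted_gram A (y - x)))\<^sup>2"
    using B(2) unfolding k_F_def grad X_mat_eq_weighted_gram weighted_gram_diff by simp
  moreover have "?M * (norm (weighted_gram A (y - x)))\<^sup>2 \<le> ?M * (?B * (norm (y - x))\<^sup>2)"
    using p by (intro mult_left_mono norm_weighted_gram_le) auto
  ultimately show ?thesis
    by (simp add: add.commute mult_ac)
qed

section \<open>Convexity and eigenvalue bounds on the feasible set\<close>

lemma convex_feasible: "convex (feasible l u N)"
proof -
  have "convex {x :: real^'m. (\<forall>i. 0 \<le> x $ i) \<and> (\<Sum>i\<in>UNIV. x $ i) = real N}"
    by (auto simp: convex_def sum.distrib distrib_right[symmetric] simp flip: sum_distrib_left)
  then show ?thesis
    unfolding feasible_def by (intro convex_Int convex_box)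
qed

text \<open>On an eigenvector \<open>w\<close> for \<open>lambda_min\<close> the form is a sum of
  nonnegative terms. If it vanished, \<open>w\<close> would be orthogonal to the chosen rows, which
  span the whole space.\<close>

lemma lambda_min_C_mat_pos:
  fixes A :: "real^'n^'m"
  assumes "card I = CARD('n)" "inj_on (\<lambda>i. row i A) I"
    and ind: "independent ((\<lambda>i. row i A) ` I)" and l: "\<And>i. i \<in> I \<Longrightarrow> l $ i \<noteq> 0"
  shows "lambda_min (C_mat A l) > 0"
proof -
  have C: "C_mat A l = weighted_gram A (real_vec l)"
    by (simp add: C_mat_def weighted_gram_def)
  obtain w where w: "w \<noteq> 0" "C_mat A l *v w = lambda_min (C_mat A l) *\<^sub>R w"
    using lambda_min_eigenvalue[of "C_mat A l"] by (auto simp: C transpose_weighted_gram eigenvalues_def)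
  have eq: "lambda_min (C_mat A l) * (w \<bullet> w) = (\<Sum>i\<in>UNIV. real (l $ i) * (row i A \<bullet> w)\<^sup>2)"
    using weighted_gram_quadratic_form[of w A "real_vec l"] w(2) by (simp add: C real_vec_def)
  have "(\<Sum>i\<in>UNIV. real (l $ i) * (row i A \<bullet> w)\<^sup>2) \<noteq> 0"
  proof
    assume "(\<Sum>i\<in>UNIV. real (l $ i) * (row i A \<bullet> w)\<^sup>2) = 0"
    then have "real (l $ i) * (row i A \<bullet> w)\<^sup>2 = 0" for i
      by (simp add: sum_nonneg_eq_0_iff)
    then have "row i A \<bullet> w = 0" if "i \<in> I" for i
      using l[OF that] by (metis mult_eq_0_iff of_nat_eq_0_iff power_eq_0_iff)
    then have "orthogonal w v" if "v \<in> (\<lambda>i. row i A) ` I" for v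
      using that by (auto simp: orthogonal_def inner_commute)
    then have "orthogonal w v" if "v \<in> span ((\<lambda>i. row i A) ` I)" for v
      using that by (meson orthogonal_to_span)
    moreover have "span ((\<lambda>i. row i A) ` I) = UNIV"
      using assms(1,2) ind
      by (metis DIM_cart DIM_real card_image dim_eq_card_independent dim_eq_full mult.right_neutral)
    ultimately have "orthogonal w w" by blast
    then show False using w by (simp add: orthogonal_def)
  qed
  moreover have "(\<Sum>i\<in>UNIV. real (l $ i) * (row i A \<bullet> w)\<^sup>2) \<ge> 0"
    by (intro sum_nonneg) auto
  ultimately have "lambda_min (C_mat A l) * (w \<bullet> w) > 0" using eq by linarith
  then show ?thesis
    using inner_ge_zero[of w] unfolding zero_less_mult_iff by linarith
qed

text \<open>Since \<open>x\<close> dominates the lower bounds entrywise, its quadratic form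
  dominates that of \<open>C_mat A l\<close>.\<close>

lemma feasible_spectrum_within:
  assumes x: "x \<in> feasible l u N" and a: "lambda_max (X_mat A l x) \<le> a"
  shows "x \<in> spectrum_within A (lambda_min (C_mat A l)) a"
proof -
  have C: "C_mat A l = weighted_gram A (real_vec l)"
    by (simp add: C_mat_def weighted_gram_def)
  have "lambda_min (C_mat A l) * (norm w)\<^sup>2 \<le> w \<bullet> (weighted_gram A x *v w)" for w
  proof -
    have "lambda_min (C_mat A l) * (norm w)\<^sup>2 \<le> w \<bullet> (C_mat A l *v w)"
      by (intro symmetric_matrix_quadratic_form_bounds) (simp add: C transpose_weighted_gram)
    also have "\<dots> \<le> w \<bullet> (weighted_gram A x *v w)"
      unfolding C weighted_gram_quadratic_form using x
      by (intro sum_mono mult_right_mono) (auto simp: feasible_def mem_box_cart)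
    finally show ?thesis .
  qed
  moreover have "w \<bullet> (weighted_gram A x *v w) \<le> a * (norm w)\<^sup>2" for w
    using symmetric_matrix_quadratic_form_bounds(2)[OF transpose_weighted_gram, of w A x] a
    by (simp add: X_mat_eq_weighted_gram) (meson mult_right_mono order_trans zero_le_power2)
  ultimately show ?thesis by (simp add: spectrum_within_def)
qed

theorem theorem2:
  fixes A :: "real^'n^'m" and l u :: "nat^'m" and N :: nat and p a_C :: real
  assumes full_column_rank: "rank A = CARD('n)"
    and bounds: "\<forall>i. l $ i \<le> u $ i"
    and N_pos: "N > 0"
    and indep_rows: "\<exists>I :: 'm set. card I = CARD('n) \<and> inj_on (\<lambda>i. row i A) I \<and>
          independent ((\<lambda>i. row i A) ` I) \<and> (\<forall>i\<in>I. l $ i \<noteq> 0)"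
    and p_pos: "p > 0"
    and a_C_bound: "\<forall>x\<in>feasible l u N. lambda_max (X_mat A l x) \<le> a_C"
    and a_C_eq: "a_C = lambda_max (C_mat A l) +
          (MAX i. real (u $ i)) * (MAX j. (norm (row j A))\<^sup>2)"
  shows "smooth_on_with
           (a_C powr p / real CARD('n) * p * (p + 1) *
              (MAX i. (A ** transpose A) $ i $ i) *
              ((spectral_norm A)\<^sup>2 / lambda_min (C_mat A l) powr (2 + p)))
           (feasible l u N) (k_F A l p)"
proof (cases "feasible l u N = {}")
  case True
  then show ?thesis by (simp add: smooth_on_with_def)
next
  case False
  define b where "b = lambda_min (C_mat A l)"
  have b: "b > 0"
    using indep_rows lambda_min_C_mat_pos unfolding b_def by blast
  have P: "x \<in> spectrum_within A b a_C" if "x \<in> feasible l u N" for x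
    unfolding b_def using a_C_bound that by (intro feasible_spectrum_within) auto
  have "a_C > 0"
  proof -
    obtain x where "x \<in> feasible l u N" using False by blast
    from P[OF this] have "b * (norm (axis undefined 1 :: real^'n))\<^sup>2 \<le> a_C * (norm (axis undefined 1 :: real^'n))\<^sup>2"
      unfolding spectrum_within_def by (blast intro: order_trans)
    then show ?thesis using b by simp
  qed
  define \<beta> where "\<beta> = (\<Sum>i\<in>UNIV. (norm (row i A))\<^sup>2)"
  have \<beta>: "\<beta> \<ge> 0" by (simp add: \<beta>_def sum_nonneg)
  define M where "M b c = c powr p / real CARD('n) * p * (p + 1) * (MAX i. (A ** transpose A) $ i $ i) *
        ((spectral_norm A)\<^sup>2 / b powr (2 + p))" for b c :: real
  \<comment> \<open>At distance up to \<open>r0\<close> the perturbed lower bound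
    \<open>b - \<beta> * r\<close> stays positive; the 1 covers \<open>\<beta> = 0\<close>.\<close>
  define r0 where "r0 = b / (\<beta> + 1)"
  have r0: "r0 > 0" using b \<beta> by (simp add: r0_def)
  have \<beta>_r: "\<beta> * r < b" if "r \<le> r0" for r
  proof -
    have "\<beta> * r \<le> \<beta> * r0" using that \<beta> by (rule mult_left_mono)
    also have "\<dots> < b" using b \<beta> by (simp add: r0_def field_simps)
    finally show ?thesis .
  qed
  \<comment> \<open>\<open>y\<close> and \<open>z\<close> need not be feasible: only the centre
    \<open>x\<close> is, and the eigenvalue bounds are widened by \<open>\<beta> * r\<close> on
    either side.\<close>
  have near: "\<bar>k_F A l p z - k_F A l p y - k_F_grad A l p y \<bullet> (z - y)\<bar>
      \<le> M (b - \<beta> * r) (a_C + \<beta> * r) / 2 * (norm (z - y))\<^sup>2"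
    if "x \<in> feasible l u N" "r \<le> r0" "norm (y - x) \<le> r" "norm (z - x) \<le> r" for x y z r
    unfolding M_def
    by (intro k_F_quadratic_bounds p_pos)
      (use that \<beta>_r spectrum_within_perturb[OF P, folded \<beta>_def] in auto)
  \<comment> \<open>Taking \<open>y = x\<close> in \<open>near\<close> gives a quadratic remainder
    on a full ball, hence differentiability in the ambient space.\<close>
  have "GDERIV (k_F A l p) x :> k_F_grad A l p x" if "x \<in> feasible l u N" for x
    by (rule GDERIV_of_quadratic_bound[OF r0], rule near[OF that order_refl])
      (use r0 in auto)
  moreover have "norm (k_F_grad A l p x - k_F_grad A l p y) \<le> M b a_C * norm (x - y)"
    if "x \<in> feasible l u N" "y \<in> feasible l u N" for x y
  proof (rule lipschitz_of_local_bound[OF convex_feasible r0 _ _ that])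
    show "((\<lambda>r. M (b - \<beta> * r) (a_C + \<beta> * r)) \<longlongrightarrow> M b a_C) (at_right 0)"
      unfolding M_def using b \<open>a_C > 0\<close> by (auto intro!: tendsto_eq_intros)
    fix x y assume xy: "x \<in> feasible l u N" "y \<in> feasible l u N" "norm (x - y) < r0"
    let ?r = "norm (x - y)" and ?U = "cball (midpoint x y) (norm (x - y) / 2)"
    \<comment> \<open>The ball with diameter from \<open>x\<close> to \<open>y\<close> lies within
      distance \<open>norm (x - y)\<close> of the feasible point \<open>x\<close>, so
      \<open>near\<close> applies with that radius.\<close>
    have "norm (z - x) \<le> ?r" if "z \<in> ?U" for z
      using that dist_triangle[of z x "midpoint x y"] dist_midpoint[of x y]
      by (auto simp: dist_norm norm_minus_commute)
    then show "norm (k_F_grad A l p x - k_F_grad A l p y) \<le> M (b - \<beta> * ?r) (a_C + \<beta> * ?r) * ?r"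
      using gradient_diff_bound_of_quadratic_bound[of ?U "k_F A l p" "k_F_grad A l p"
          "M (b - \<beta> * ?r) (a_C + \<beta> * ?r)" x y] near[OF xy(1), of ?r] xy(3)
      by auto
  qed
  ultimately show ?thesis
    unfolding smooth_on_with_def M_def b_def by blast
qed

end
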